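(* Let $b\ge1$ and let $\alpha_1,\dots,\alpha_b$ be primitive sequences. For each $j$, if $\alpha_j=(t_1,\dots,t_{\ell-1})$, let $V_j=\{2,\,2(1+t_1),\,\dots,\,2(1+t_1+\cdots+t_{\ell-1})\}$. Let $k_1,\dots,k_b$ be integers with $k_1\ge -1$ and $k_{j+1}\ge \max(V_j+k_j)-1$ for $1\le j\le b-1$, where $W+k=\{w+k: w\in W\}$, and let $V=(V_1+k_1)\cup\cdots\cup(V_b+k_b)$. Then the sequence $H(D^{(m,V)})$ of Hankel determinants is periodic for every integer $m\ge\max(V)$.
   Context: For an integer $m\ge 2$ and $V\subseteq[m]=\{1,\dots,m\}$, let $(m,V)=\{k\in\mathbb{Z}^+ : k\equiv j \pmod m \text{ for some } j\in V\}$. A Dyck path of size $n$ is a lattice path from $(0,0)$ to $(2n,0)$ with steps $(1,1)$ and $(1,-1)$ never going below the $x$-axis; a peak is an up-step immediately followed by a down-step, and its height is the $y$-coordinate of the point between them. Let $d_n^{(m,V)}$ be the number of Dyck paths of size $n$ none of whose peaks has height in $(m,V)$, and $D^{(m,V)}(x)=\sum_{n\ge0}d_n^{(m,V)}x^n$. For a power series $F=\sum f_nx^n$ and $n\ge1$, $H_n(F)=\det(f_{i+j})_{0\le i,j\le n-1}$ and $H(F)=(H_1(F),H_2(F),\dots)$. For positive integers $t_1,t_2,\dots$ define rationals $h(t_1)=2-t_1$ and $h(t_1,\dots,t_j)=2-t_j-1/h(t_1,\dots,t_{j-1})$ for $j\ge2$. A sequence $(t_1,\dots,t_b)$ ($b\ge0$)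 of positive integers is admissible if $h(t_1),\dots,h(t_1,\dots,t_b)$ are all nonzero (the empty sequence is admissible). A sequence $(t_1,\dots,t_{b+1})$ of positive integers is primitive if $(t_1,\dots,t_b)$ is admissible and $h(t_1,\dots,t_{b+1})=0$. *)

theory Defs
  imports
    "HOL-Number_Theory.Cong"
    "HOL-Computational_Algebra.Formal_Power_Series"
    "Jordan_Normal_Form.Determinant"
begin

(* A lattice path from the origin is the list of the y-components (1 or -1) of its steps; the
   x-component of every step is 1, so the point reached after i steps is (i, path_height p i). *)

definition path_height :: "int list \<Rightarrow> nat \<Rightarrow> int" where
  "path_height p i = sum_list (take i p)"

definition dyck_paths :: "nat \<Rightarrow> int list set" where
  "dyck_paths n = {p. length p = 2 * n \<and> set p \<subseteq> {1, -1} \<and>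
     (\<forall>i\<le>2 * n. path_height p i \<ge> 0) \<and> path_height p (2 * n) = 0}"

definition peak_heights :: "int list \<Rightarrow> int set" where
  "peak_heights p =
     {path_height p (Suc i) |i. Suc i < length p \<and> p ! i = 1 \<and> p ! Suc i = -1}"

definition residue_set :: "int \<Rightarrow> int set \<Rightarrow> int set" where
  "residue_set m V = {k. k > 0 \<and> (\<exists>j\<in>V. [k = j] (mod m))}"

definition dyck_count :: "int \<Rightarrow> int set \<Rightarrow> nat \<Rightarrow> nat" where
  "dyck_count m V n = card {p \<in> dyck_paths n. peak_heights p \<inter> residue_set m V = {}}"

definition dyck_gf :: "int \<Rightarrow> int set \<Rightarrow> int fps" where
  "dyck_gf m V = Abs_fps (\<lambda>n. int (dyck_count m V n))"

definition hankel_det :: "nat \<Rightarrow> 'a::comm_ring_1 fps \<Rightarrow> 'a" where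
  "hankel_det n F = det (mat n n (\<lambda>(i, j). fps_nth F (i + j)))"

(* The sequence starts with the determinant of order 1, not with the empty determinant. *)
definition hankel_seq :: "'a::comm_ring_1 fps \<Rightarrow> nat \<Rightarrow> 'a" where
  "hankel_seq F = (\<lambda>n. hankel_det (Suc n) F)"

definition periodic :: "(nat \<Rightarrow> 'a) \<Rightarrow> bool" where
  "periodic s \<longleftrightarrow> (\<exists>p>0. \<forall>n. s (n + p) = s n)"

(* hval [t1,...,tj] is h(t1,...,tj); the recursion on the last entry is hval_single, hval_snoc.
   The value on the empty list is arbitrary, and values that arise through a division by zero
   never matter, since every nonempty proper prefix is required to have a nonzero value wherever
   hval is used. *)
definition hval :: "nat list \<Rightarrow> rat" where
  "hval ts = foldl (\<lambda>r t. 2 - of_nat t - 1 / r) (2 - of_nat (hd ts)) (tl ts)"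

lemma hval_single: "hval [t] = 2 - of_nat t"
  by (simp add: hval_def)

lemma hval_snoc: "ts \<noteq> [] \<Longrightarrow> hval (ts @ [t]) = 2 - of_nat t - 1 / hval ts"
  by (cases ts) (simp_all add: hval_def)

definition admissible :: "nat list \<Rightarrow> bool" where
  "admissible ts \<longleftrightarrow> (\<forall>t\<in>set ts. t > 0) \<and> (\<forall>j\<in>{1..length ts}. hval (take j ts) \<noteq> 0)"

definition primitive :: "nat list \<Rightarrow> bool" where
  "primitive ts \<longleftrightarrow>
     ts \<noteq> [] \<and> (\<forall>t\<in>set ts. t > 0) \<and> admissible (butlast ts) \<and> hval ts = 0"

definition height_set :: "nat list \<Rightarrow> int set" where
  "height_set ts = {2 * (1 + int (sum_list (take i ts))) |i. i \<le> length ts}"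

definition shift_set :: "int set \<Rightarrow> int \<Rightarrow> int set" where
  "shift_set W k = (\<lambda>w. w + k) ` W"

end

theory Submission
  imports Defs
begin

text \<open>
  Let \<open>F\<^sub>h\<close> be the generating function for paths starting at height \<open>h\<close>. The first-return
  decomposition gives \<open>F\<^sub>h = 1 / (1 + \<chi>\<^bsub>h+1\<^esub> x - x F\<^bsub>h+1\<^esub>)\<close>, where \<open>\<chi>\<close> indicates
  the forbidden heights, so \<open>F\<^sub>0\<close> is a Moebius transform of \<open>F\<^bsub>2m\<^esub> = F\<^sub>0\<close> with a matrix of
  determinant \<open>x\<^bsup>2m\<^esup>\<close>.
  Put \<open>y = 1/x\<close> and \<open>f = F/y\<close>. If the matrix acting on \<open>f\<close>, divided by \<open>x\<^sup>m\<close>, is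
  polynomial in \<open>y\<close> (hence unimodular), then column operations on the Hankel matrix give
  \<open>H\<^bsub>m+n\<^esub>(F) = H\<^sub>m(F) H\<^sub>n(F)\<close> with \<open>H\<^sub>m(F) = \<plusminus>1\<close>, whence period \<open>2m\<close>.

  Polynomiality is a degree bound on the matrix. Two steps of which the second is not forbidden respect it.
  Along a block of forbidden heights with half-gaps \<open>t\<^sub>1, t\<^sub>2, \<dots>\<close> of the right parity, it fails
  by one leading coefficient, which is up to sign and a common factor the product of the values
  \<open>h(t\<^sub>1), h(t\<^sub>1, t\<^sub>2), \<dots>\<close> and therefore vanishes at the end of a primitive sequence.
\<close>

unbundle fps_syntax
no_notation vec_index (infixl "$" 100)

subsection \<open>Hankel determinants under unimodular Moebius transforms\<close>

lemma fps_mult_nth_beyond_degrees: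
  fixes p q :: "'a::comm_ring_1 fps"
  assumes "\<And>t. t > a \<Longrightarrow> p $ t = 0" and "\<And>t. t \<ge> b \<Longrightarrow> q $ t = 0" and "t \<ge> a + b"
  shows "(p * q) $ t = 0"
proof -
  have "p $ i * q $ (t - i) = 0" for i
    using assms by (cases "i > a") auto
  then show ?thesis by (simp add: fps_mult_nth)
qed

text \<open>Combining Hankel columns with the reversed coefficients of \<open>P\<close> is a
  convolution; \<open>hi\<close> and \<open>lo\<close> ensure that the N available columns catch
  every nonzero coefficient of \<open>P\<close>.\<close>

lemma hankel_column:
  fixes F P :: "'a::comm_ring_1 fps"
  assumes hi: "\<And>t. t > d \<Longrightarrow> P $ t = 0" and lo: "\<And>t. t + N \<le> d \<Longrightarrow> P $ t = 0"
  shows "(\<Sum>k<N. F $ (i + k) * (if k \<le> d then P $ (d - k) else 0)) = (F * P) $ (i + d)"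
proof -
  have "(\<Sum>k<N. F $ (i + k) * (if k \<le> d then P $ (d - k) else 0))
      = (\<Sum>k\<in>{k. k < N \<and> k \<le> d}. F $ (i + k) * P $ (d - k))"
    by (rule sum.mono_neutral_cong_right) auto
  also have "\<dots> = (\<Sum>l\<in>(\<lambda>k. i + k) ` {k. k < N \<and> k \<le> d}. F $ l * P $ (i + d - l))"
    by (subst sum.reindex) (auto simp: inj_on_def)
  also have "\<dots> = (\<Sum>l=0..i+d. F $ l * P $ (i + d - l))"
  proof (rule sum.mono_neutral_left)
    show "\<forall>l\<in>{0..i + d} - (\<lambda>k. i + k) ` {k. k < N \<and> k \<le> d}. F $ l * P $ (i + d - l) = 0"
    proof
      fix l assume l: "l \<in> {0..i + d} - (\<lambda>k. i + k) ` {k. k < N \<and> k \<le> d}"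
      show "F $ l * P $ (i + d - l) = 0"
      proof (cases "l < i")
        case True
        then show ?thesis by (simp add: hi)
      next
        case False
        have "\<not> (l - i < N \<and> l - i \<le> d)"
        proof
          assume "l - i < N \<and> l - i \<le> d"
          then have "l \<in> (\<lambda>k. i + k) ` {k. k < N \<and> k \<le> d}"
            using False by (intro image_eqI[of _ _ "l - i"]) auto
          then show False using l by blast
        qed
        then have "i + d - l + N \<le> d" using l False by auto
        then show ?thesis by (simp add: lo)
      qed
    qed
  qed auto
  finally show ?thesis by (simp add: fps_mult_nth)
qed

abbreviation hankel_mat :: "nat \<Rightarrow> 'a::comm_ring_1 fps \<Rightarrow> 'a mat" where
  "hankel_mat n F \<equiv> mat n n (\<lambda>(i, j). F $ (i + j))"

lemma prod_list_diag_const: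
  assumes "A \<in> carrier_mat n n" and "\<And>i. i < n \<Longrightarrow> A $$ (i, i) = c"
  shows "prod_list (diag_mat A) = c ^ n"
proof -
  have "diag_mat A = replicate n c"
    using assms by (intro nth_equalityI) (auto simp: diag_mat_def)
  then show ?thesis by (simp add: prod_list_replicate)
qed

text \<open>With F = y f, G = y g and y = 1/x, dividing the matrix that acts on g by x^M gives the
  entries \<alpha>/x^M, \<beta>/x^(M-1), \<gamma>/x^(M+1), \<delta>/x^M. The four degree bounds make
  them polynomials in y, and \<open>det\<close> makes their determinant 1.\<close>

locale hankel_moebius =
  fixes F G \<alpha> \<beta> \<gamma> \<delta> :: "'a::idom fps" and M :: nat
  assumes deg_\<alpha>: "\<And>t. t > M \<Longrightarrow> \<alpha> $ t = 0"
    and deg_\<beta>: "\<And>t. t \<ge> M \<Longrightarrow> \<beta> $ t = 0"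
    and deg_\<gamma>: "\<And>t. t > M + 1 \<Longrightarrow> \<gamma> $ t = 0"
    and deg_\<delta>: "\<And>t. t > M \<Longrightarrow> \<delta> $ t = 0"
    and \<gamma>_0: "\<gamma> $ 0 = 0" and \<delta>_0: "\<delta> $ 0 = 1"
    and det: "\<alpha> * \<delta> - \<beta> * \<gamma> = fps_X ^ (2 * M)"
    and moebius: "F * (\<gamma> * G + \<delta>) = \<alpha> * G + \<beta>"
    and M_pos: "M > 0"
begin

definition denom_inv :: "'a fps" where "denom_inv = fps_right_inverse (\<gamma> * G + \<delta>) 1"

lemma denom_inv_inverse: "(\<gamma> * G + \<delta>) * denom_inv = 1"
  unfolding denom_inv_def by (rule fps_right_inverse) (simp add: \<gamma>_0 \<delta>_0)

lemma denom_inv_0: "denom_inv $ 0 = 1"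
  by (simp add: denom_inv_def)

text \<open>Inserting the unit \<gamma> G + \<delta> and its inverse brings out the determinant as a
  factor of the error, so \<beta>/\<delta> agrees with F up to order x^(2M), as in Pade
  approximation.\<close>

lemma \<delta>_F: "\<delta> * F = \<beta> + fps_X ^ (2 * M) * G * denom_inv"
proof -
  have "\<delta> * F - \<beta> = (\<delta> * F - \<beta>) * ((\<gamma> * G + \<delta>) * denom_inv)" by (simp add: denom_inv_inverse)
  also have "\<dots> = (\<delta> * (F * (\<gamma> * G + \<delta>)) - \<beta> * (\<gamma> * G + \<delta>)) * denom_inv" by (simp add: algebra_simps)
  also have "\<dots> = (\<alpha> * \<delta> - \<beta> * \<gamma>) * G * denom_inv" unfolding moebius by (simp add: algebra_simps)
  finally show ?thesis by (simp add: det algebra_simps)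
qed

lemma \<gamma>_F: "\<gamma> * F = \<alpha> - fps_X ^ (2 * M) * denom_inv"
proof -
  have "\<alpha> - \<gamma> * F = (\<alpha> - \<gamma> * F) * ((\<gamma> * G + \<delta>) * denom_inv)" by (simp add: denom_inv_inverse)
  also have "\<dots> = (\<alpha> * (\<gamma> * G + \<delta>) - \<gamma> * (F * (\<gamma> * G + \<delta>))) * denom_inv" by (simp add: algebra_simps)
  also have "\<dots> = (\<alpha> * \<delta> - \<beta> * \<gamma>) * denom_inv" unfolding moebius by (simp add: algebra_simps)
  finally show ?thesis by (simp add: det algebra_simps)
qed

text \<open>
  With \<open>y = 1/x\<close>, \<open>f = F/y\<close> and \<open>g = G/y\<close> the relation is \<open>f = (a g + b) / (c g + d)\<close>. Read backwards, \<open>gap_col j\<close> is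
  \<open>d y\<^sup>j + c [y\<^sup>j g]\<close>, where the bracket is the polynomial part; because of this correction its product
  with \<open>F\<close> has a gap of length \<open>M\<close>.
\<close>
definition gap_col :: "nat \<Rightarrow> 'a fps" where
  "gap_col j = \<delta> + \<gamma> * fps_cutoff j G"

lemma F_gap_col: "F * gap_col j = (\<beta> + \<alpha> * fps_cutoff j G) + fps_X ^ (2 * M + j) * (denom_inv * fps_shift j G)"
proof -
  have "F * gap_col j = \<delta> * F + \<gamma> * F * fps_cutoff j G" by (simp add: gap_col_def algebra_simps)
  also have "\<dots> = (\<beta> + \<alpha> * fps_cutoff j G) + fps_X ^ (2 * M) * denom_inv * (G - fps_cutoff j G)"
    unfolding \<delta>_F \<gamma>_F by (simp add: algebra_simps)
  also have "G - fps_cutoff j G = fps_shift j G * fps_X ^ j"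
    using fps_shift_cutoff[of j G] by (metis add_diff_cancel_right')
  finally show ?thesis by (simp add: algebra_simps power_add)
qed

lemma gap_col_beyond: "t > M + j \<Longrightarrow> gap_col j $ t = 0"
  using fps_mult_nth_beyond_degrees[of "M + 1" \<gamma> j "fps_cutoff j G" t]
  by (simp add: gap_col_def deg_\<gamma> deg_\<delta>)

lemma gap_col_0: "gap_col j $ 0 = 1"
  by (simp add: gap_col_def \<gamma>_0 \<delta>_0)

text \<open>The polynomial part of the product ends below degree M + j and the tail starts at 2M +
  j, which leaves M zero coefficients in between.\<close>

lemma F_gap_col_nth:
  "(F * gap_col j) $ (i + (M + j)) = (if i < M then 0 else (denom_inv * fps_shift j G) $ (i - M))"
proof -
  have "(\<beta> + \<alpha> * fps_cutoff j G) $ (i + (M + j)) = 0"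
    using fps_mult_nth_beyond_degrees[of M \<alpha> j "fps_cutoff j G" "i + (M + j)"]
    by (simp add: deg_\<alpha> deg_\<beta>)
  then show ?thesis
    unfolding F_gap_col by (auto simp: fps_X_power_mult_nth)
qed

text \<open>The first M columns are those of the identity. Column l >= M holds
  \<open>gap_col (l - M)\<close>, of degree at most l, reversed so that its constant term 1 lies on
  the diagonal.\<close>

definition gap_mat :: "nat \<Rightarrow> 'a mat" where
  "gap_mat n = mat (M + n) (M + n) (\<lambda>(k, l).
     if l < M then if k = l then 1 else 0 else if k \<le> l then gap_col (l - M) $ (l - k) else 0)"

lemma det_gap_mat: "det (gap_mat n) = 1"
proof -
  have c: "gap_mat n \<in> carrier_mat (M + n) (M + n)" by (simp add: gap_mat_def)
  have "det (gap_mat n) = prod_list (diag_mat (gap_mat n))"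
    by (rule det_upper_triangular[OF _ c]) (auto simp: gap_mat_def)
  also have "\<dots> = 1 ^ (M + n)"
    by (rule prod_list_diag_const[OF c]) (auto simp: gap_mat_def gap_col_0)
  finally show ?thesis by simp
qed

lemma hankel_times_gap_mat:
  assumes "i < M + n" and "l < M + n"
  shows "(hankel_mat (M + n) F * gap_mat n) $$ (i, l) =
    (if l < M then F $ (i + l) else if i < M then 0 else (denom_inv * fps_shift (l - M) G) $ (i - M))"
proof -
  have *: "(hankel_mat (M + n) F * gap_mat n) $$ (i, l) =
      (\<Sum>k<M + n. F $ (i + k) * gap_mat n $$ (k, l))"
    using assms by (simp add: gap_mat_def scalar_prod_def atLeast0LessThan)
  show ?thesis
  proof (cases "l < M")
    case True
    have "(\<Sum>k<M + n. F $ (i + k) * gap_mat n $$ (k, l)) = (\<Sum>k<M + n. if k = l then F $ (i + k) else 0)"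
      using True assms by (intro sum.cong) (auto simp: gap_mat_def)
    then show ?thesis unfolding * using True by simp
  next
    case False
    have "(\<Sum>k<M + n. F $ (i + k) * gap_mat n $$ (k, l)) =
        (\<Sum>k<M + n. F $ (i + k) * (if k \<le> l then gap_col (l - M) $ (l - k) else 0))"
      using False assms by (intro sum.cong) (auto simp: gap_mat_def)
    also have "\<dots> = (F * gap_col (l - M)) $ (i + l)"
      by (rule hankel_column) (use False assms gap_col_beyond[of "l - M"] in auto)
    also have "\<dots> = (if i < M then 0 else (denom_inv * fps_shift (l - M) G) $ (i - M))"
      using F_gap_col_nth[of "l - M" i] False by simp
    finally show ?thesis unfolding * using False by simp
  qed
qed

text \<open>The gap makes the product with \<open>gap_mat n\<close> block lower triangular. Its
  second diagonal block is the Hankel matrix of G up to a unitriangular factor.\<close>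

lemma hankel_det_shift:
  "hankel_det (M + n) F = hankel_det M F * hankel_det n G"
proof -
  \<comment> \<open>This is truncated multiplication by \<open>denom_inv\<close>; its diagonal is
    the constant term 1.\<close>
  define T where "T = mat n n (\<lambda>(i, k). if k \<le> i then denom_inv $ (i - k) else 0)"
  define B where "B = mat n M (\<lambda>(i, k). F $ (M + i + k))"
  have Tc: "T \<in> carrier_mat n n" by (simp add: T_def)
  have "det T = prod_list (diag_mat T)"
    by (rule det_lower_triangular[OF _ Tc]) (auto simp: T_def)
  also have "\<dots> = 1 ^ n"
    by (rule prod_list_diag_const[OF Tc]) (auto simp: T_def denom_inv_0)
  finally have detT: "det T = 1" by simp
  have TG: "(T * hankel_mat n G) $$ (i, j) = (denom_inv * fps_shift j G) $ i" if "i < n" "j < n" for i j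
  proof -
    have "(T * hankel_mat n G) $$ (i, j) = (\<Sum>k<n. T $$ (i, k) * G $ (k + j))"
      using that by (simp add: T_def scalar_prod_def atLeast0LessThan)
    also have "\<dots> = (\<Sum>k=0..i. G $ (k + j) * denom_inv $ (i - k))"
      using that by (intro sum.mono_neutral_cong_right) (auto simp: T_def)
    also have "\<dots> = (fps_shift j G * denom_inv) $ i"
      by (simp add: fps_mult_nth)
    finally show ?thesis by (simp add: mult.commute)
  qed
  have "hankel_mat (M + n) F * gap_mat n =
      four_block_mat (hankel_mat M F) (0\<^sub>m M n) B (T * hankel_mat n G)"
  proof (rule eq_matI)
    fix i j
    assume "i < dim_row (four_block_mat (hankel_mat M F) (0\<^sub>m M n) B (T * hankel_mat n G))"
      and "j < dim_col (four_block_mat (hankel_mat M F) (0\<^sub>m M n) B (T * hankel_mat n G))"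
    then have ij: "i < M + n" "j < M + n" by (simp_all add: T_def B_def)
    then show "(hankel_mat (M + n) F * gap_mat n) $$ (i, j) =
        four_block_mat (hankel_mat M F) (0\<^sub>m M n) B (T * hankel_mat n G) $$ (i, j)"
      unfolding hankel_times_gap_mat[OF ij]
      using TG[of "i - M" "j - M"] by (auto simp: B_def T_def)
  qed (auto simp: T_def B_def gap_mat_def)
  then have "det (hankel_mat (M + n) F * gap_mat n) = det (hankel_mat M F) * det (T * hankel_mat n G)"
    using det_four_block_mat_upper_right_zero[of "hankel_mat M F" M "0\<^sub>m M n" n B "T * hankel_mat n G"]
      mult_carrier_mat[OF Tc, of "hankel_mat n G" n] by (simp add: B_def)
  moreover have "det (hankel_mat (M + n) F * gap_mat n) = det (hankel_mat (M + n) F)"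
    using det_mult[of "hankel_mat (M + n) F" "M + n" "gap_mat n"] det_gap_mat
    by (simp add: gap_mat_def)
  moreover have "det (T * hankel_mat n G) = det (hankel_mat n G)"
    using det_mult[OF Tc, of "hankel_mat n G"] detT by simp
  ultimately show ?thesis by (simp add: hankel_det_def)
qed

text \<open>
  In \<open>y = 1/x\<close> these are the remainders of \<open>c y\<^sup>j\<close> modulo \<open>d\<close>: multiplication by \<open>c\<close> on the
  residue ring modulo \<open>d\<close> is invertible, since \<open>c\<close> and \<open>d\<close> form a row of a unimodular matrix.
\<close>
definition quot_poly :: "nat \<Rightarrow> 'a fps" where
  "quot_poly j = fps_cutoff (Suc j) (fps_shift 1 \<gamma> * fps_right_inverse \<delta> 1)"

definition residue_col :: "nat \<Rightarrow> 'a fps" where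
  "residue_col j = fps_shift 1 \<gamma> - \<delta> * quot_poly j"

lemma residue_col_beyond: "t > M + j \<Longrightarrow> residue_col j $ t = 0"
  using fps_mult_nth_beyond_degrees[of M \<delta> "Suc j" "quot_poly j" t]
  by (simp add: residue_col_def quot_poly_def deg_\<gamma> deg_\<delta>)

text \<open>\<open>quot_poly j\<close> truncates the series \<gamma>/(x \<delta>) after degree j, so
  what remains of it, times \<delta>, starts at degree j + 1.\<close>

lemma residue_col_below: "t \<le> j \<Longrightarrow> residue_col j $ t = 0"
proof -
  assume t: "t \<le> j"
  define e where "e = fps_shift 1 \<gamma> * fps_right_inverse \<delta> 1"
  have "\<delta> * e = fps_shift 1 \<gamma> * (\<delta> * fps_right_inverse \<delta> 1)" by (simp add: e_def algebra_simps)
  also have "\<dots> = fps_shift 1 \<gamma>" using fps_right_inverse[of \<delta> 1] by (simp add: \<delta>_0)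
  finally have "residue_col j = \<delta> * (e - fps_cutoff (Suc j) e)"
    by (simp add: residue_col_def quot_poly_def e_def algebra_simps)
  also have "e - fps_cutoff (Suc j) e = fps_X ^ Suc j * fps_shift (Suc j) e"
    using fps_shift_cutoff[of "Suc j" e] by (metis add_diff_cancel_right' mult.commute)
  finally have "residue_col j = fps_X ^ Suc j * (\<delta> * fps_shift (Suc j) e)"
    by (simp only: ac_simps)
  then show ?thesis using t by (simp only: fps_X_power_mult_nth) simp
qed

lemma X_shift_\<gamma>: "fps_X * fps_shift 1 \<gamma> = \<gamma>"
  by (rule fps_ext) (auto simp: \<gamma>_0)

lemma F_residue_col:
  "fps_X * (F * residue_col j) =
     \<alpha> - fps_X * (\<beta> * quot_poly j) - fps_X ^ (2 * M) * (denom_inv * (1 + fps_X * G * quot_poly j))"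
proof -
  have "fps_X * (F * residue_col j) = (fps_X * fps_shift 1 \<gamma>) * F - fps_X * (\<delta> * F) * quot_poly j"
    by (simp only: residue_col_def) (simp add: algebra_simps)
  also have "\<dots> = \<alpha> - fps_X ^ (2 * M) * denom_inv - fps_X * (\<beta> + fps_X ^ (2 * M) * G * denom_inv) * quot_poly j"
    unfolding X_shift_\<gamma> \<delta>_F \<gamma>_F ..
  finally show ?thesis by (simp add: algebra_simps)
qed

text \<open>After multiplication by x the coefficient sits at i + j + M + 1. This is beyond the
  degrees of \<alpha> and x \<beta> \<open>quot_poly j\<close>, and it reaches 2M only for i + j + 1
  = M, where the constant term of \<open>denom_inv\<close> enters with sign -1.\<close>

lemma F_residue_col_nth:
  assumes "i + j < M"
  shows "(F * residue_col j) $ (i + (M + j)) = (if i + j + 1 = M then -1 else 0)"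
proof -
  have "(\<beta> * quot_poly j) $ (i + (M + j)) = 0"
    using fps_mult_nth_beyond_degrees[of "M - 1" \<beta> "Suc j" "quot_poly j" "i + (M + j)"] M_pos
    by (simp add: deg_\<beta> quot_poly_def)
  then have "(fps_X * (F * residue_col j)) $ Suc (i + (M + j)) = (if i + j + 1 = M then -1 else 0)"
    unfolding F_residue_col using assms by (auto simp: fps_X_power_mult_nth deg_\<alpha> denom_inv_0 mult.assoc)
  then show ?thesis by simp
qed

text \<open>The residue columns turn the Hankel matrix into a lower triangular one with diagonal -1,
  so its determinant divides a power of -1.\<close>

lemma hankel_det_unit: "hankel_det M F dvd 1"
proof -
  \<comment> \<open>The residues are taken in decreasing order j = M - 1 - l, since i + j + 1 = M
    then means i = l.\<close>
  define R where "R = mat M M (\<lambda>(k, l). residue_col (M - 1 - l) $ (M + (M - 1 - l) - k))"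
  have Rc: "R \<in> carrier_mat M M" by (simp add: R_def)
  have HR: "(hankel_mat M F * R) $$ (i, l) = (if i = l then -1 else 0)" if "i \<le> l" "l < M" for i l
  proof -
    define j where "j = M - 1 - l"
    have "(hankel_mat M F * R) $$ (i, l) = (\<Sum>k<M. F $ (i + k) * (if k \<le> M + j then residue_col j $ (M + j - k) else 0))"
      using that unfolding R_def j_def
      by (simp add: scalar_prod_def atLeast0LessThan) (intro sum.cong, auto)
    also have "\<dots> = (F * residue_col j) $ (i + (M + j))"
      by (rule hankel_column) (auto simp: residue_col_beyond residue_col_below)
    also have "\<dots> = (if i + j + 1 = M then -1 else 0)"
      by (rule F_residue_col_nth) (use that M_pos in \<open>auto simp: j_def\<close>)
    finally show ?thesis using that by (auto simp: j_def)
  qed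
  have c: "hankel_mat M F * R \<in> carrier_mat M M"
    using mult_carrier_mat[OF _ Rc, of "hankel_mat M F" M] by simp
  have "det (hankel_mat M F * R) = prod_list (diag_mat (hankel_mat M F * R))"
    by (rule det_lower_triangular[OF _ c]) (use HR in auto)
  also have "\<dots> = (-1) ^ M"
    by (rule prod_list_diag_const[OF c]) (use HR in auto)
  finally have "hankel_det M F * det R = (-1) ^ M"
    using det_mult[OF _ Rc, of "hankel_mat M F"] by (simp add: hankel_det_def)
  then have "hankel_det M F dvd (-1) ^ M" by (metis dvd_triv_left)
  moreover have "(-1 :: 'a) ^ M * (-1) ^ M = 1" by (simp flip: power_mult_distrib)
  then have "(-1 :: 'a) ^ M dvd 1" by (metis dvd_triv_left)
  ultimately show ?thesis by (rule dvd_trans)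
qed

end

subsection \<open>Degrees of continued fraction convergents\<close>

definition x_if :: "(nat \<Rightarrow> bool) \<Rightarrow> nat \<Rightarrow> int fps" where
  "x_if \<chi> h = (if \<chi> h then fps_X else 0)"

text \<open>One step multiplies the row on the right by the matrix with rows (0, 1) and (-x, 1 +
  \<chi> x), the Moebius matrix of one level of the continued fraction.\<close>

primrec cf_row :: "(nat \<Rightarrow> bool) \<Rightarrow> int fps \<times> int fps \<Rightarrow> nat \<Rightarrow> int fps \<times> int fps" where
  "cf_row \<chi> p 0 = p"
| "cf_row \<chi> p (Suc s) = (- fps_X * snd (cf_row \<chi> p s),
     fst (cf_row \<chi> p s) + (1 + x_if \<chi> (Suc s)) * snd (cf_row \<chi> p s))"

text \<open>
  The bounds are those of a row of a polynomial matrix in \<open>y = 1/x\<close> after the entries have been rescaled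
  by powers of \<open>x\<close>: two steps multiply by \<open>x\<close>, that is, raise \<open>N\<close> by one. A forbidden
  height at the second step breaks the bounds by one degree.
\<close>
definition reduced :: "nat \<Rightarrow> int fps \<times> int fps \<Rightarrow> bool" where
  "reduced N p \<longleftrightarrow> (\<forall>t>N. fst p $ t = 0) \<and> (\<forall>t\<ge>N. snd p $ t = 0)"

text \<open>The coefficient \<nu> measures the failure of \<open>reduced N\<close>: with \<nu> = 0
  the bounds hold again.\<close>

definition unreduced :: "nat \<Rightarrow> int \<Rightarrow> int \<Rightarrow> int fps \<times> int fps \<Rightarrow> bool" where
  "unreduced N \<mu> \<nu> p \<longleftrightarrow> (\<forall>t>N. fst p $ t = 0 \<and> snd p $ t = 0) \<and> fst p $ N = \<mu> \<and> snd p $ N = \<nu>"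

text \<open>A forbidden height s + 1 raises the degree of the second entry from below N to at most
  N, which is still within the bound after the second step.\<close>

lemma reduced_pair:
  assumes "reduced N (cf_row \<chi> p s)" and "\<not> \<chi> (s + 2)"
  shows "reduced (Suc N) (cf_row \<chi> p (s + 2))"
proof -
  have "\<not> \<chi> (Suc (Suc s))" using assms(2) by simp
  then show ?thesis
    using assms(1) unfolding reduced_def
    by (auto simp: x_if_def algebra_simps)
qed

lemma reduced_advance:
  assumes "reduced N (cf_row \<chi> p s)" and "\<And>i. i < n \<Longrightarrow> \<not> \<chi> (s + 2 * Suc i)"
  shows "reduced (N + n) (cf_row \<chi> p (s + 2 * n))"
  using assms(2)
proof (induction n)
  case 0
  then show ?case using assms(1) by simp
next
  case (Suc n)
  have "reduced (Suc (N + n)) (cf_row \<chi> p (s + 2 * n + 2))"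
    by (rule reduced_pair) (use Suc.IH Suc.prems Suc.prems[of n] in auto)
  then show ?case by (simp add: add_ac)
qed

text \<open>The second step multiplies an entry of degree at most N by 1 + x; its coefficient at N
  becomes, up to sign, the leading coefficient of both new entries.\<close>

lemma unreduced_of_reduced:
  assumes "reduced N (cf_row \<chi> p s)" and "\<chi> (s + 2)"
  shows "\<exists>\<omega>. unreduced (Suc N) (- \<omega>) \<omega> (cf_row \<chi> p (s + 2))"
proof
  have "\<chi> (Suc (Suc s))" using assms(2) by simp
  then show "unreduced (Suc N) (- (snd (cf_row \<chi> p (Suc s)) $ N)) (snd (cf_row \<chi> p (Suc s)) $ N) (cf_row \<chi> p (s + 2))"
    using assms(1) unfolding unreduced_def reduced_def
    by (auto simp: x_if_def algebra_simps)
qed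

text \<open>Here s + 1 must be allowed: the second entry may already have degree N, and a factor 1 +
  x could raise it too far.\<close>

lemma unreduced_pair:
  assumes "unreduced N \<mu> \<nu> (cf_row \<chi> p s)" and "\<not> \<chi> (s + 1)"
  shows "unreduced (Suc N) (- (\<mu> + \<nu>)) (if \<chi> (s + 2) then \<mu> else - \<nu>) (cf_row \<chi> p (s + 2))"
  using assms unfolding unreduced_def
  by (auto simp: x_if_def algebra_simps)

text \<open>On the leading coefficients an allowed pair of steps acts as minus a unipotent matrix,
  hence the linear growth in n.\<close>

lemma unreduced_advance:
  assumes "unreduced N \<mu> \<nu> (cf_row \<chi> p s)" and "\<And>h. s < h \<Longrightarrow> h \<le> s + 2 * n \<Longrightarrow> \<not> \<chi> h"
  shows "unreduced (N + n) ((-1) ^ n * (\<mu> + int n * \<nu>)) ((-1) ^ n * \<nu>) (cf_row \<chi> p (s + 2 * n))"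
  using assms(2)
proof (induction n)
  case 0
  then show ?case using assms(1) by simp
next
  case (Suc n)
  have "unreduced (Suc (N + n)) (- ((-1) ^ n * (\<mu> + int n * \<nu>) + (-1) ^ n * \<nu>))
    (if \<chi> (s + 2 * n + 2) then (-1) ^ n * (\<mu> + int n * \<nu>) else - ((-1) ^ n * \<nu>)) (cf_row \<chi> p (s + 2 * n + 2))"
    by (rule unreduced_pair) (use Suc.IH Suc.prems in auto)
  moreover have "\<not> \<chi> (s + 2 * n + 2)" using Suc.prems by simp
  ultimately show ?case by (simp add: algebra_simps)
qed

text \<open>
  The ratio of the two leading coefficients \<open>\<mu>, \<nu>\<close> follows the recursion of \<^const>\<open>hval\<close>:
  \<open>\<nu> / (\<mu> + \<nu>)\<close> is the value of \<^const>\<open>hval\<close> on the gaps passed so far (it is infinite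
  on the empty sequence).
\<close>
lemma unreduced_block:
  assumes start: "reduced N (cf_row \<chi> p s)"
    and pos: "\<forall>t\<in>set ts. t > 0"
    and nonzero: "\<And>j. 1 \<le> j \<Longrightarrow> j < length ts \<Longrightarrow> hval (take j ts) \<noteq> 0"
    and pattern: "\<And>h. s + 1 < h \<Longrightarrow> h \<le> s + 2 * (1 + sum_list ts) \<Longrightarrow>
      \<chi> h \<longleftrightarrow> (\<exists>i\<le>length ts. h = s + 2 * (1 + sum_list (take i ts)))"
  shows "\<exists>\<omega> \<mu> \<nu>. unreduced (Suc N + sum_list ts) (\<omega> * \<mu>) (\<omega> * \<nu>) (cf_row \<chi> p (s + 2 * (1 + sum_list ts))) \<and>
    (if ts = [] then \<mu> = -1 \<and> \<nu> = 1
     else \<mu> + \<nu> \<noteq> 0 \<and> (of_int \<nu> :: rat) = hval ts * of_int (\<mu> + \<nu>))"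
  using pos nonzero pattern
proof (induction ts rule: rev_induct)
  case Nil
  then have "\<chi> (s + 2)" by simp
  \<comment> \<open>Nothing excludes \<omega> = 0, so it is split off as a common factor and the
    ratio is tracked on the normalized pair (-1, 1).\<close>
  from unreduced_of_reduced[OF start this] obtain \<omega> where "unreduced (Suc N) (- \<omega>) \<omega> (cf_row \<chi> p (s + 2))" ..
  then show ?case by (intro exI[of _ \<omega>] exI[of _ "-1"] exI[of _ 1]) simp
next
  case (snoc t ts)
  have t: "t > 0" using snoc.prems(1) by simp
  define s' where "s' = s + 2 * (1 + sum_list ts)"
  have "\<exists>\<omega> \<mu> \<nu>. unreduced (Suc N + sum_list ts) (\<omega> * \<mu>) (\<omega> * \<nu>) (cf_row \<chi> p s') \<and>
    (if ts = [] then \<mu> = -1 \<and> \<nu> = 1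
     else \<mu> + \<nu> \<noteq> 0 \<and> (of_int \<nu> :: rat) = hval ts * of_int (\<mu> + \<nu>))"
    unfolding s'_def
  proof (rule snoc.IH)
    show "\<forall>t\<in>set ts. t > 0" using snoc.prems(1) by simp
    show "hval (take j ts) \<noteq> 0" if "1 \<le> j" "j < length ts" for j
      using snoc.prems(2)[of j] that by simp
    show "\<chi> h \<longleftrightarrow> (\<exists>i\<le>length ts. h = s + 2 * (1 + sum_list (take i ts)))"
      if "s + 1 < h" "h \<le> s + 2 * (1 + sum_list ts)" for h
    proof -
      have "\<chi> h \<longleftrightarrow> (\<exists>i\<le>Suc (length ts). h = s + 2 * (1 + sum_list (take i (ts @ [t]))))"
        using snoc.prems(3)[of h] that by simp
      then show ?thesis using that t by (auto simp: le_Suc_eq)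
    qed
  qed
  then obtain \<omega> \<mu> \<nu> where m: "unreduced (Suc N + sum_list ts) (\<omega> * \<mu>) (\<omega> * \<nu>) (cf_row \<chi> p s')"
    and val: "if ts = [] then \<mu> = -1 \<and> \<nu> = 1
     else \<mu> + \<nu> \<noteq> 0 \<and> (of_int \<nu> :: rat) = hval ts * of_int (\<mu> + \<nu>)" by blast
  have gap: "\<chi> h \<longleftrightarrow> h = s' + 2 * t" if "s' < h" "h \<le> s' + 2 * t" for h
  proof -
    have le: "sum_list (take i ts) \<le> sum_list ts" for i
      by (metis append_take_drop_id le_add1 sum_list_append)
    have "\<chi> h \<longleftrightarrow> (\<exists>i\<le>Suc (length ts). h = s + 2 * (1 + sum_list (take i (ts @ [t]))))"
      using snoc.prems(3)[of h] that by (simp add: s'_def)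
    also have "\<dots> \<longleftrightarrow> (\<exists>i\<le>length ts. h = s + 2 * (1 + sum_list (take i ts))) \<or> h = s' + 2 * t"
      by (auto simp: le_Suc_eq s'_def)
    finally show ?thesis using that le unfolding s'_def
      by (metis add_left_mono leD mult_le_mono2)
  qed
  \<comment> \<open>Of the t pairs of steps in the gap, the first t - 1 are free and contribute this
    sign; the last pair ends on the forbidden height.\<close>
  define e :: int where "e = (-1) ^ (t - 1)"
  have "unreduced (Suc N + sum_list ts + (t - 1)) (e * (\<omega> * \<mu> + int (t - 1) * (\<omega> * \<nu>))) (e * (\<omega> * \<nu>))
    (cf_row \<chi> p (s' + 2 * (t - 1)))"
    unfolding e_def by (rule unreduced_advance[OF m]) (use gap t in auto)
  note pair = unreduced_pair[OF this]
  have end_eq: "s' + 2 * (t - 1) + 2 = s + 2 * (1 + sum_list (ts @ [t]))"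
    and end_N: "Suc (Suc N + sum_list ts + (t - 1)) = Suc N + sum_list (ts @ [t])"
    using t by (simp_all add: s'_def)
  have "\<not> \<chi> (s' + 2 * (t - 1) + 1)" "\<chi> (s' + 2 * (t - 1) + 2)"
    using gap t by auto
  then have "unreduced (Suc N + sum_list (ts @ [t])) (- (e * (\<omega> * \<mu> + int (t - 1) * (\<omega> * \<nu>)) + e * (\<omega> * \<nu>)))
    (e * (\<omega> * \<mu> + int (t - 1) * (\<omega> * \<nu>))) (cf_row \<chi> p (s + 2 * (1 + sum_list (ts @ [t]))))"
    using pair unfolding end_eq end_N by simp
  then have "unreduced (Suc N + sum_list (ts @ [t])) ((\<omega> * e) * (- (\<mu> + int t * \<nu>)))
    ((\<omega> * e) * (\<mu> + int (t - 1) * \<nu>)) (cf_row \<chi> p (s + 2 * (1 + sum_list (ts @ [t]))))"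
    using t by (simp add: algebra_simps of_nat_diff)
  \<comment> \<open>The new ratio is (\<mu> + (t-1) \<nu>) / (-\<nu>) = 2 - t - (\<mu> +
    \<nu>)/\<nu>, which is the recursion of \<open>hval\<close>. For the empty sequence \<mu> +
    \<nu> = 0, and the ratio becomes 2 - t.\<close>
  moreover have "- (\<mu> + int t * \<nu>) + (\<mu> + int (t - 1) * \<nu>) \<noteq> 0 \<and>
    (of_int (\<mu> + int (t - 1) * \<nu>) :: rat)
      = hval (ts @ [t]) * of_int (- (\<mu> + int t * \<nu>) + (\<mu> + int (t - 1) * \<nu>))"
  proof (cases "ts = []")
    case True
    then show ?thesis using val t by (simp add: hval_single of_nat_diff)
  next
    case False
    have h: "hval ts \<noteq> 0" using snoc.prems(2)[of "length ts"] False by (simp add: Suc_le_eq)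
    have \<nu>: "\<mu> + \<nu> \<noteq> 0" "(of_int \<nu> :: rat) = hval ts * of_int (\<mu> + \<nu>)" using val False by auto
    have eq: "- (\<mu> + int t * \<nu>) + (\<mu> + int (t - 1) * \<nu>) = - \<nu>"
      using t by (simp add: algebra_simps of_nat_diff)
    have ne: "\<nu> \<noteq> 0"
    proof
      assume "\<nu> = 0"
      then have "hval ts * of_int (\<mu> + \<nu>) = 0" using \<nu>(2) by (metis of_int_0)
      then show False using h \<nu>(1) by (metis mult_eq_0_iff of_int_eq_0_iff)
    qed
    have "(1 / hval ts) * of_int \<nu> = (of_int (\<mu> + \<nu>) :: rat)"
      unfolding \<nu>(2) using h by simp
    then have "hval (ts @ [t]) * of_int (- \<nu>) = of_int (\<mu> + \<nu>) - (2 - of_nat t) * of_int \<nu>"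
      by (simp add: hval_snoc[OF False] algebra_simps)
    also have "\<dots> = of_int (\<mu> + int (t - 1) * \<nu>)"
      using t by (simp add: algebra_simps of_nat_diff)
    finally show ?thesis unfolding eq using ne by simp
  qed
  ultimately show ?case
    by (intro exI[of _ "\<omega> * e"] exI[of _ "- (\<mu> + int t * \<nu>)"] exI[of _ "\<mu> + int (t - 1) * \<nu>"]) simp
qed

text \<open>Primitivity forces \<nu> = 0 at the end, which restores the bound. The pattern starts
  above s + 1 because the top of the preceding block may lie at s + 1.\<close>

lemma reduced_block:
  assumes start: "reduced N (cf_row \<chi> p s)" and prim: "primitive ts"
    and pattern: "\<And>h. s + 1 < h \<Longrightarrow> h \<le> s + 2 * (1 + sum_list ts) \<Longrightarrow>
      \<chi> h \<longleftrightarrow> (\<exists>i\<le>length ts. h = s + 2 * (1 + sum_list (take i ts)))"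
  shows "reduced (N + (1 + sum_list ts)) (cf_row \<chi> p (s + 2 * (1 + sum_list ts)))"
proof -
  have "hval (take j ts) \<noteq> 0" if "1 \<le> j" "j < length ts" for j
  proof -
    have "take j (butlast ts) = take j ts" using that by (simp add: take_butlast)
    then show ?thesis using prim that unfolding primitive_def admissible_def
      by (metis One_nat_def Suc_pred atLeastAtMost_iff length_butlast length_greater_0_conv less_Suc_eq_le)
  qed
  then obtain \<omega> \<mu> \<nu> where
    m: "unreduced (Suc N + sum_list ts) (\<omega> * \<mu>) (\<omega> * \<nu>) (cf_row \<chi> p (s + 2 * (1 + sum_list ts)))"
    and val: "if ts = [] then \<mu> = -1 \<and> \<nu> = 1
     else \<mu> + \<nu> \<noteq> 0 \<and> (of_int \<nu> :: rat) = hval ts * of_int (\<mu> + \<nu>)"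
    using unreduced_block[OF start _ _ pattern] prim unfolding primitive_def by blast
  have "\<nu> = 0" using val prim by (simp add: primitive_def)
  then show ?thesis using m unfolding reduced_def unreduced_def by (auto simp: le_less)
qed

subsection \<open>The forbidden heights over two periods\<close>

lemma sum_list_take_le: "sum_list (take i ts) \<le> sum_list (ts :: nat list)"
  by (metis append_take_drop_id le_add1 sum_list_append)

lemma finite_height_set: "finite (height_set ts)"
  unfolding height_set_def by simp

lemma Max_shift_height_set:
  "Max (shift_set (height_set ts) c) = c + 2 * (1 + int (sum_list ts))"
proof (rule Max_eqI)
  show "finite (shift_set (height_set ts) c)"
    by (simp add: shift_set_def finite_height_set)
  show "y \<le> c + 2 * (1 + int (sum_list ts))" if "y \<in> shift_set (height_set ts) c" for y
    using that sum_list_take_le[of _ ts] by (auto simp: shift_set_def height_set_def)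
  show "c + 2 * (1 + int (sum_list ts)) \<in> shift_set (height_set ts) c"
    unfolding shift_set_def height_set_def
    by (rule image_eqI[of _ _ "2 * (1 + int (sum_list ts))"]) (auto intro!: exI[of _ "length ts"])
qed

locale peak_blocks =
  fixes b :: nat and \<alpha> :: "nat \<Rightarrow> nat list" and k :: "nat \<Rightarrow> int"
    and V :: "int set" and m :: int
  assumes b: "b \<ge> 1"
    and prim: "\<And>j. j \<in> {1..b} \<Longrightarrow> primitive (\<alpha> j)"
    and k_1: "k 1 \<ge> -1"
    and k_step: "\<And>j. 1 \<le> j \<Longrightarrow> j \<le> b - 1 \<Longrightarrow>
           k (j + 1) \<ge> Max (shift_set (height_set (\<alpha> j)) (k j)) - 1"
    and V: "V = (\<Union>j\<in>{1..b}. shift_set (height_set (\<alpha> j)) (k j))"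
    and m: "m \<ge> Max V"
begin

text \<open>The value 0 at j = 0 makes the bound on \<open>k 1\<close> the first case of
  \<open>k_ge\<close>.\<close>

definition block_top :: "nat \<Rightarrow> int" where
  "block_top j = (if j = 0 then 0 else k j + 2 * (1 + int (sum_list (\<alpha> j))))"

lemma k_ge: "j < b \<Longrightarrow> k (Suc j) \<ge> block_top j - 1"
  using k_1 k_step[of j] by (auto simp: block_top_def Max_shift_height_set)

lemma top_Suc: "block_top (Suc j) = k (Suc j) + 2 * (1 + int (sum_list (\<alpha> (Suc j))))"
  by (simp add: block_top_def)

lemma block_top_mono: "i \<le> j \<Longrightarrow> j \<le> b \<Longrightarrow> block_top i \<le> block_top j"
proof (induction j rule: dec_induct)
  case (step j)
  then show ?case using k_ge[of j] by (simp add: top_Suc)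
qed simp

text \<open>The smallest height of block j is k j + 2, which exceeds the previous top; the blocks
  therefore occupy disjoint intervals.\<close>

lemma block_bounds:
  assumes "v \<in> shift_set (height_set (\<alpha> j)) (k j)" and "1 \<le> j" and "j \<le> b"
  shows "block_top (j - 1) < v" and "v \<le> block_top j"
proof -
  obtain i where "v = k j + 2 * (1 + int (sum_list (take i (\<alpha> j))))"
    using assms(1) by (auto simp: shift_set_def height_set_def)
  moreover have "k j \<ge> block_top (j - 1) - 1" using k_ge[of "j - 1"] assms(2,3) by simp
  moreover have "block_top j = k j + 2 * (1 + int (sum_list (\<alpha> j)))"
    using assms(2) by (simp add: block_top_def)
  ultimately show "block_top (j - 1) < v" "v \<le> block_top j"
    using sum_list_take_le[of i "\<alpha> j"] by simp_all
qed

lemma top_le_m: "block_top b \<le> m"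
proof -
  have "finite V" unfolding V by (auto simp: shift_set_def finite_height_set)
  moreover have "block_top b \<in> V"
    unfolding V using b
    by (auto simp: block_top_def shift_set_def height_set_def intro!: bexI[of _ b] image_eqI[of _ _ "2 * (1 + int (sum_list (\<alpha> b)))"] exI[of _ "length (\<alpha> b)"])
  ultimately show ?thesis using m Max_ge[of V "block_top b"] by linarith
qed

lemma m_pos: "m > 0"
  using top_le_m block_top_mono[of 1 b] k_1 b by (simp add: block_top_def)

lemma V_bounds: "v \<in> V \<Longrightarrow> 0 < v \<and> v \<le> block_top b"
proof -
  assume "v \<in> V"
  then obtain j where j: "1 \<le> j" "j \<le> b" "v \<in> shift_set (height_set (\<alpha> j)) (k j)"
    unfolding V by auto
  have "block_top 0 \<le> block_top (j - 1)" "block_top j \<le> block_top b"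
    using j by (auto intro!: block_top_mono)
  moreover have "block_top 0 = 0" by (simp add: block_top_def)
  ultimately show ?thesis using block_bounds[OF j(3,1,2)] by linarith
qed

text \<open>V lies in {1..m}, so a window of m consecutive heights contains exactly one
  representative of each member of V.\<close>

lemma mem_residue_set:
  assumes "int r * m < h" and "h \<le> int r * m + m"
  shows "h \<in> residue_set m V \<longleftrightarrow> h - int r * m \<in> V"
proof
  assume "h \<in> residue_set m V"
  then obtain j where j: "j \<in> V" "[h = j] (mod m)" by (auto simp: residue_set_def)
  have jb: "0 < j" "j \<le> m" using V_bounds[OF j(1)] top_le_m by auto
  from j(2) obtain c where c: "h = j + m * c" by (metis cong_iff_lin cong_sym)
  have "c = int r"
  proof -
    have e: "h - int r * m = j + m * (c - int r)" using c by (simp add: algebra_simps)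
    have "\<not> c - int r \<ge> 1"
    proof
      assume "c - int r \<ge> 1"
      then have "m * 1 \<le> m * (c - int r)" using m_pos by (intro mult_left_mono) auto
      then show False using e assms jb by linarith
    qed
    moreover have "\<not> c - int r \<le> -1"
    proof
      assume "c - int r \<le> -1"
      then have "m * (c - int r) \<le> m * (-1)" using m_pos by (intro mult_left_mono) auto
      then show False using e assms jb by linarith
    qed
    ultimately show ?thesis by linarith
  qed
  then show "h - int r * m \<in> V" using c j(1) by (simp add: algebra_simps)
next
  assume "h - int r * m \<in> V"
  moreover have "h > 0" using assms(1) m_pos by (smt (verit) of_nat_0_le_iff mult_nonneg_nonneg)
  moreover have "[h = h - int r * m] (mod m)" by (simp add: cong_iff_dvd_diff)
  ultimately show "h \<in> residue_set m V" by (auto simp: residue_set_def)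
qed

lemma mem_residue_set_block:
  assumes "j < b" and "int r * m + block_top j < h" and "h \<le> int r * m + block_top (Suc j)"
  shows "h \<in> residue_set m V \<longleftrightarrow>
    (\<exists>i\<le>length (\<alpha> (Suc j)). h = int r * m + k (Suc j) + 2 * (1 + int (sum_list (take i (\<alpha> (Suc j))))))"
proof -
  have "block_top 0 \<le> block_top j" "block_top (Suc j) \<le> block_top b" using assms(1) by (auto intro!: block_top_mono)
  then have "h \<in> residue_set m V \<longleftrightarrow> h - int r * m \<in> V"
    using assms top_le_m by (intro mem_residue_set) (auto simp: block_top_def)
  also have "\<dots> \<longleftrightarrow> h - int r * m \<in> shift_set (height_set (\<alpha> (Suc j))) (k (Suc j))"
  proof
    assume "h - int r * m \<in> V"
    then obtain i where i: "1 \<le> i" "i \<le> b" "h - int r * m \<in> shift_set (height_set (\<alpha> i)) (k i)"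
      unfolding V by auto
    have "\<not> i \<le> j"
      using block_bounds(2)[OF i(3,1,2)] block_top_mono[of i j] assms by linarith
    moreover have "\<not> Suc j \<le> i - 1"
      using block_bounds(1)[OF i(3,1,2)] block_top_mono[of "Suc j" "i - 1"] assms i by linarith
    ultimately have "i = Suc j" by simp
    then show "h - int r * m \<in> shift_set (height_set (\<alpha> (Suc j))) (k (Suc j))" using i by simp
  next
    assume "h - int r * m \<in> shift_set (height_set (\<alpha> (Suc j))) (k (Suc j))"
    then show "h - int r * m \<in> V" unfolding V using assms(1) by (auto intro!: bexI[of _ "Suc j"])
  qed
  also have "\<dots> \<longleftrightarrow> (\<exists>i\<le>length (\<alpha> (Suc j)). h = int r * m + k (Suc j) + 2 * (1 + int (sum_list (take i (\<alpha> (Suc j))))))"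
    by (auto simp: shift_set_def height_set_def image_iff)
  finally show ?thesis .
qed

lemma not_mem_residue_set_tail:
  assumes "int r * m + block_top b < h" and "h \<le> int r * m + m"
  shows "h \<notin> residue_set m V"
  using mem_residue_set[of r h] V_bounds[of "h - int r * m"] block_top_mono[of 0 b] assms
  by (auto simp: block_top_def)

section \<open>Propagation of the degree bound through two periods of heights\<close>

definition forbidden :: "nat \<Rightarrow> bool" where
  "forbidden h \<longleftrightarrow> int h \<in> residue_set m V"

text \<open>
  Only even heights matter. A block whose forbidden heights are even is crossed as a whole, by
  \<open>reduced_block\<close>; a block whose forbidden heights are odd is invisible.
\<close>
definition reduced_at :: "nat \<Rightarrow> bool" where
  "reduced_at s \<longleftrightarrow> even s \<and> (\<forall>p N. reduced N p \<longrightarrow> reduced (N + s div 2) (cf_row forbidden p s))"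

lemma reduced_at_advance:
  assumes "reduced_at s" and "s \<le> s'" and "even s'"
    and free: "\<And>h. s < h \<Longrightarrow> h \<le> s' \<Longrightarrow> even h \<Longrightarrow> \<not> forbidden h"
  shows "reduced_at s'"
proof -
  define n where "n = (s' - s) div 2"
  have s': "s' = s + 2 * n" and es: "even s" using assms by (auto simp: n_def reduced_at_def)
  have "reduced (N + s div 2 + n) (cf_row forbidden p (s + 2 * n))" if "reduced N p" for N p
  proof (rule reduced_advance)
    show "reduced (N + s div 2) (cf_row forbidden p s)" using assms(1) that unfolding reduced_at_def by blast
  qed (use free es s' in auto)
  then show ?thesis using es by (auto simp: reduced_at_def s' add_ac)
qed

lemma reduced_at_block:
  assumes "reduced_at s" and "primitive ts"
    and "\<And>h. s + 1 < h \<Longrightarrow> h \<le> s + 2 * (1 + sum_list ts) \<Longrightarrow>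
      forbidden h \<longleftrightarrow> (\<exists>i\<le>length ts. h = s + 2 * (1 + sum_list (take i ts)))"
  shows "reduced_at (s + 2 * (1 + sum_list ts))"
proof -
  have es: "even s" using assms(1) by (simp add: reduced_at_def)
  have "reduced (N + s div 2 + (1 + sum_list ts)) (cf_row forbidden p (s + 2 * (1 + sum_list ts)))" if "reduced N p" for N p
  proof (rule reduced_block[OF _ assms(2,3)])
    show "reduced (N + s div 2) (cf_row forbidden p s)" using assms(1) that unfolding reduced_at_def by blast
  qed
  then show ?thesis using es by (auto simp: reduced_at_def add_ac)
qed

text \<open>The position s is even, hence it is the top of block j or the height just below it,
  according to parity. The next block is crossed from \<open>B\<close> if \<open>B\<close> is even;
  otherwise all its heights are odd and only free even heights are passed.\<close>

lemma reduced_at_next_block: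
  assumes s: "reduced_at s" "int s \<in> {int r * m + block_top j - 1, int r * m + block_top j}" and j: "j < b"
  shows "\<exists>s'. reduced_at s' \<and> int s' \<in> {int r * m + block_top (Suc j) - 1, int r * m + block_top (Suc j)}"
proof -
  define B where "B = int r * m + k (Suc j)"
  have es: "even (int s)" using s(1) by (simp add: reduced_at_def)
  have B_ge: "int r * m + block_top j - 1 \<le> B" using k_ge[OF j] by (simp add: B_def)
  have top_B: "int r * m + block_top (Suc j) = B + 2 * (1 + int (sum_list (\<alpha> (Suc j))))"
    by (simp add: B_def top_Suc)
  have past: "int r * m + block_top j < int h" if "s < h" "even h" for h
  proof -
    have "s + 2 \<le> h" using that es by presburger
    then show ?thesis using s(2) by auto
  qed
  have hit: "forbidden h \<longleftrightarrow> (\<exists>i\<le>length (\<alpha> (Suc j)). int h = B + 2 * (1 + int (sum_list (take i (\<alpha> (Suc j))))))"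
    if "int r * m + block_top j < int h" "int h \<le> int r * m + block_top (Suc j)" for h
    using mem_residue_set_block[OF j that] by (simp add: forbidden_def B_def)
  show ?thesis
  proof (cases "even B")
    case True
    \<comment> \<open>The hypothesis on k permits \<open>B\<close> to lie one below the previous
      top; parity then rules out s = B + 1.\<close>
    have "int s \<le> B + 1" using s(2) B_ge by auto
    then have sB: "int s \<le> B" using True es by presburger
    define n where "n = nat B"
    have n: "int n = B" using sB by (simp add: n_def)
    have "reduced_at n"
    proof (rule reduced_at_advance[OF s(1)])
      show "s \<le> n" using n sB by simp
      have "even (int n)" using n True by simp
      then show "even n" by simp
      show "\<not> forbidden h" if "s < h" "h \<le> n" "even h" for h
        using hit[OF past[OF that(1,3)]] that n top_B by auto
    qed
    then have "reduced_at (n + 2 * (1 + sum_list (\<alpha> (Suc j))))"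
    proof (rule reduced_at_block)
      show "primitive (\<alpha> (Suc j))" using prim j by simp
      show "forbidden h \<longleftrightarrow> (\<exists>i\<le>length (\<alpha> (Suc j)). h = n + 2 * (1 + sum_list (take i (\<alpha> (Suc j)))))"
        if "n + 1 < h" "h \<le> n + 2 * (1 + sum_list (\<alpha> (Suc j)))" for h
      proof -
        have "int h = B + 2 * (1 + int (sum_list (take i (\<alpha> (Suc j))))) \<longleftrightarrow>
          h = n + 2 * (1 + sum_list (take i (\<alpha> (Suc j))))" for i
          using n by auto
        then show ?thesis using hit[of h] that n B_ge top_B by auto
      qed
    qed
    then show ?thesis using n top_B by (intro exI[of _ "n + 2 * (1 + sum_list (\<alpha> (Suc j)))"]) auto
  next
    case False
    define n where "n = nat (int r * m + block_top (Suc j) - 1)"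
    have le: "int s \<le> int r * m + block_top (Suc j) - 1" using s(2) B_ge top_B by auto
    then have n: "int n = int r * m + block_top (Suc j) - 1" by (simp add: n_def)
    have "reduced_at n"
    proof (rule reduced_at_advance[OF s(1)])
      show "s \<le> n" using le n by simp
      have "even (int n)" unfolding n top_B using False by simp
      then show "even n" by simp
      show "\<not> forbidden h" if "s < h" "h \<le> n" "even h" for h
      proof
        assume "forbidden h"
        moreover have "int h \<le> int r * m + block_top (Suc j)" using that(2) n by simp
        ultimately obtain i where "int h = B + 2 * (1 + int (sum_list (take i (\<alpha> (Suc j)))))"
          using hit[OF past[OF \<open>s < h\<close> \<open>even h\<close>]] by blast
        moreover have "even (int h)" using that by simp
        ultimately show False using False by simp
      qed
    qed
    then show ?thesis using n by auto
  qed
qed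

text \<open>Within a period the blocks are crossed one by one, and the heights above the last block
  are free. If r m is odd, the position reached is one lower.\<close>

lemma reduced_at_period:
  "\<exists>s. reduced_at s \<and> int s \<in> {int r * m - 1, int r * m}"
proof (induction r)
  case 0
  have "reduced_at 0" by (simp add: reduced_at_def)
  then show ?case by (intro exI[of _ 0]) simp
next
  case (Suc r)
  have "\<exists>s. reduced_at s \<and> int s \<in> {int r * m + block_top j - 1, int r * m + block_top j}" if "j \<le> b" for j
    using that
  proof (induction j)
    case 0
    then show ?case using \<open>\<exists>s. reduced_at s \<and> int s \<in> {int r * m - 1, int r * m}\<close> by (simp add: block_top_def)
  next
    case (Suc j)
    then show ?case using reduced_at_next_block[of _ r j] by auto
  qed
  then obtain s where s: "reduced_at s" "int s \<in> {int r * m + block_top b - 1, int r * m + block_top b}" by blast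
  have es: "even (int s)" using s(1) by (simp add: reduced_at_def)
  define e where "e = int r * m + m"
  define n where "n = nat (if even e then e else e - 1)"
  have le: "int s \<le> (if even e then e else e - 1)"
  proof -
    have "int s \<le> e" using s(2) top_le_m by (auto simp: e_def)
    then show ?thesis using es by (cases "int s = e") auto
  qed
  then have n: "int n = (if even e then e else e - 1)" by (simp add: n_def)
  have "reduced_at n"
  proof (rule reduced_at_advance[OF s(1)])
    show "s \<le> n" using le n by linarith
    have "even (int n)" unfolding n by simp
    then show "even n" by simp
    show "\<not> forbidden h" if "s < h" "h \<le> n" "even h" for h
    proof -
      have "s + 2 \<le> h" using that es by presburger
      then have "int r * m + block_top b < int h" using s(2) by auto
      moreover have "int h \<le> int r * m + m" using that n by (auto simp: e_def split: if_splits)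
      ultimately show ?thesis unfolding forbidden_def by (rule not_mem_residue_set_tail)
    qed
  qed
  moreover have "int n \<in> {int (Suc r) * m - 1, int (Suc r) * m}"
    using n by (auto simp: e_def algebra_simps split: if_splits)
  ultimately show ?case by blast
qed

lemma reduced_at_two_periods: "reduced_at (2 * nat m)"
proof -
  obtain s where s: "reduced_at s" "int s \<in> {2 * m - 1, 2 * m}" using reduced_at_period[of 2] by auto
  have "even (int s)" using s(1) by (simp add: reduced_at_def)
  then have "int s \<noteq> 2 * m - 1" by presburger
  then have "int s = 2 * m" using s(2) by auto
  then have "s = 2 * nat m" by linarith
  then show ?thesis using s(1) by simp
qed

end

subsection \<open>First-return decomposition\<close>

lemma dyck_paths_altdef:
  "p \<in> dyck_paths n \<longleftrightarrow> length p = 2 * n \<and> set p \<subseteq> {1, -1} \<and>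
     (\<forall>u v. p = u @ v \<longrightarrow> sum_list u \<ge> 0) \<and> sum_list p = 0"
proof -
  have "(\<forall>i\<le>length p. path_height p i \<ge> 0) \<longleftrightarrow> (\<forall>u v. p = u @ v \<longrightarrow> sum_list u \<ge> 0)"
    unfolding path_height_def by (metis append_eq_conv_conj append_take_drop_id le_add1 length_append)
  moreover have "length p = 2 * n \<Longrightarrow> path_height p (2 * n) = sum_list p"
    by (simp add: path_height_def)
  ultimately show ?thesis by (auto simp: dyck_paths_def)
qed

lemma peak_heights_altdef:
  "peak_heights p = {sum_list u + 1 |u v. p = u @ 1 # -1 # v}"
proof (intro equalityI subsetI)
  fix h assume "h \<in> peak_heights p"
  then obtain i where i: "h = path_height p (Suc i)" "Suc i < length p" "p ! i = 1" "p ! Suc i = -1"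
    by (auto simp: peak_heights_def)
  have "p = take i p @ 1 # -1 # drop (Suc (Suc i)) p"
    using i by (metis Cons_nth_drop_Suc Suc_lessD append_take_drop_id)
  moreover have "h = sum_list (take i p) + 1"
    using i by (simp add: path_height_def take_Suc_conv_app_nth)
  ultimately show "h \<in> {sum_list u + 1 |u v. p = u @ 1 # -1 # v}" by blast
next
  fix h assume "h \<in> {sum_list u + 1 |u v. p = u @ 1 # -1 # v}"
  then obtain u v where "h = sum_list u + 1" "p = u @ 1 # -1 # v" by blast
  then show "h \<in> peak_heights p"
    unfolding peak_heights_def path_height_def
    by (intro CollectI exI[of _ "length u"]) (simp add: nth_append)
qed

lemma finite_dyck_paths: "finite (dyck_paths n)"
proof (rule finite_subset)
  show "dyck_paths n \<subseteq> {p. set p \<subseteq> {1, -1} \<and> length p = 2 * n}"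
    by (auto simp: dyck_paths_def)
qed (simp add: finite_lists_length_eq)

lemma dyck_paths_0: "dyck_paths 0 = {[]}"
  by (auto simp: dyck_paths_altdef)

text \<open>The down-step after q is the first return to the axis.\<close>

definition arch :: "int list \<times> int list \<Rightarrow> int list" where
  "arch = (\<lambda>(q, r). 1 # q @ -1 # r)"

lemma dyck_paths_prefix: "p \<in> dyck_paths n \<Longrightarrow> p = u @ v \<Longrightarrow> sum_list u \<ge> 0"
  by (simp add: dyck_paths_altdef)

lemma arch_in_dyck_paths:
  assumes q: "q \<in> dyck_paths i" and r: "r \<in> dyck_paths j"
  shows "arch (q, r) \<in> dyck_paths (Suc (i + j))"
proof -
  have q0: "sum_list q = 0" using q by (simp add: dyck_paths_altdef)
  have "sum_list u \<ge> 0" if "1 # q @ -1 # r = u @ v" for u v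
  proof (cases u)
    case (Cons a u')
    then have a: "a = 1" and e: "q @ -1 # r = u' @ v" using that by auto
    obtain us where "q = u' @ us \<and> us @ -1 # r = v \<or> q @ us = u' \<and> -1 # r = us @ v"
      using e unfolding append_eq_append_conv2 by (elim exE)
    then consider "q = u' @ us" | "u' = q @ us" "us @ v = -1 # r"
      by (elim disjE conjE) (simp_all only: refl)
    then have "sum_list u' \<ge> -1"
    proof cases
      case 1
      then show ?thesis using dyck_paths_prefix[OF q 1] by simp
    next
      case 2
      show ?thesis
      proof (cases us)
        case Nil
        then show ?thesis using 2 q0 by simp
      next
        case (Cons c us')
        then have r_eq: "r = us' @ v" and c: "c = -1" using 2(2) by simp_all
        have "sum_list us' \<ge> 0" by (rule dyck_paths_prefix[OF r r_eq])
        then show ?thesis using 2(1) Cons c q0 by simp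
      qed
    qed
    then show ?thesis using Cons a by simp
  qed simp
  moreover have "length (arch (q, r)) = 2 * Suc (i + j)" "set (arch (q, r)) \<subseteq> {1, -1}" "sum_list (arch (q, r)) = 0"
    using q r by (auto simp: dyck_paths_altdef arch_def)
  moreover have "arch (q, r) = 1 # q @ -1 # r" by (simp add: arch_def)
  ultimately show ?thesis unfolding dyck_paths_altdef by metis
qed

text \<open>If one interior were longer, it would have the other one followed by a down-step as a
  prefix, which ends below the axis.\<close>

lemma inj_arch: "inj_on arch (\<Union>i\<le>n. dyck_paths i \<times> dyck_paths (n - i))"
proof (rule inj_onI, clarify)
  fix q r q' r' i i'
  assume q: "q \<in> dyck_paths i" and q': "q' \<in> dyck_paths i'" and eq: "arch (q, r) = arch (q', r')"
  have *: "us = []" if "q1 = q2 @ us" "us @ -1 # r1 = -1 # r2" "q1 \<in> dyck_paths j" "q2 \<in> dyck_paths j'"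
    for q1 q2 us r1 r2 j j'
  proof (rule ccontr)
    assume "us \<noteq> []"
    with that(2) have "us = -1 # tl us" by (cases us) auto
    then have "sum_list (q2 @ [-1]) \<ge> 0" using dyck_paths_prefix[OF that(3), of "q2 @ [-1]" "tl us"] that(1)
      by (metis append.assoc append_Cons append_Nil)
    then show False using that(4) by (simp add: dyck_paths_altdef)
  qed
  from eq have "q @ -1 # r = q' @ -1 # r'" by (simp add: arch_def)
  then obtain us where "q = q' @ us \<and> us @ -1 # r = -1 # r' \<or> q @ us = q' \<and> -1 # r = us @ -1 # r'"
    unfolding append_eq_append_conv2 by (elim exE)
  then have "q = q'"
  proof (elim disjE conjE)
    assume a: "q = q' @ us" "us @ -1 # r = -1 # r'"
    show ?thesis using *[OF a q q'] a(1) by simp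
  next
    assume a: "q @ us = q'" "-1 # r = us @ -1 # r'"
    show ?thesis using *[OF a(1)[symmetric] a(2)[symmetric] q' q] a(1) by simp
  qed
  then show "q = q' \<and> r = r'" using eq by (simp add: arch_def)
qed

lemma dyck_paths_Suc:
  "dyck_paths (Suc n) = arch ` (\<Union>i\<le>n. dyck_paths i \<times> dyck_paths (n - i))"
proof (intro equalityI subsetI)
  fix p assume "p \<in> arch ` (\<Union>i\<le>n. dyck_paths i \<times> dyck_paths (n - i))"
  then show "p \<in> dyck_paths (Suc n)" using arch_in_dyck_paths by fastforce
next
  fix p assume p: "p \<in> dyck_paths (Suc n)"
  then obtain a p' where ap: "p = a # p'" by (cases p) (auto simp: dyck_paths_altdef)
  have a: "a = 1"
    using dyck_paths_prefix[OF p, of "[a]" p'] p ap by (auto simp: dyck_paths_altdef)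
  have tot: "sum_list p' = -1" using p ap a by (simp add: dyck_paths_altdef)
  \<comment> \<open>With the initial up-step removed, the first return to the axis is the first
    prefix of sum -1.\<close>
  define l where "l = (LEAST l. sum_list (take l p') = -1)"
  have ex: "sum_list (take (length p') p') = -1" using tot by simp
  then have l1: "sum_list (take l p') = -1" unfolding l_def by (rule LeastI)
  have l2: "l \<le> length p'" unfolding l_def by (rule Least_le) (rule ex)
  have l3: "sum_list (take i p') \<noteq> -1" if "i < l" for i using not_less_Least that unfolding l_def by blast
  have ge: "sum_list (take i p') \<ge> -1" for i
    using dyck_paths_prefix[OF p, of "1 # take i p'" "drop i p'"] ap a by simp
  have "l \<noteq> 0" using l1 by (cases "l = 0") auto
  then obtain s where s: "l = Suc s" using not0_implies_Suc by blast
  have sl: "s < length p'" using s l2 by simp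
  define q r where "q = take s p'" and "r = drop l p'"
  have step: "sum_list (take l p') = sum_list q + p' ! s"
    using sl by (simp add: s q_def take_Suc_conv_app_nth)
  have set: "set p' \<subseteq> {1, -1}" using p ap by (simp add: dyck_paths_altdef)
  then have "p' ! s \<in> {1, -1}" using sl nth_mem by blast
  moreover have "sum_list q \<ge> 0" using l3[of s] ge[of s] s by (simp add: q_def)
  ultimately have ps: "p' ! s = -1" and q0: "sum_list q = 0" using step l1 by auto
  have p'_eq: "p' = q @ -1 # r"
    using id_take_nth_drop[OF sl] ps by (simp add: q_def r_def s)
  have qpos: "sum_list u \<ge> 0" if "q = u @ v" for u v
  proof -
    have "length u \<le> s" using that sl by (metis le_add1 length_append length_take min.cobounded2 le_trans q_def)
    moreover have "u = take (length u) p'" using that p'_eq by simp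
    ultimately show ?thesis using l3[of "length u"] ge[of "length u"] s by auto
  qed
  \<comment> \<open>Length and height have the same parity, so the interior q has even
    length.\<close>
  have par: "even (length u + nat \<bar>sum_list u\<bar>)" if "set u \<subseteq> {1, -1}" for u :: "int list"
    using that
  proof (induction u)
    case (Cons c u)
    have "even (length u + nat \<bar>sum_list u\<bar>)" using Cons by simp
    moreover have "c = 1 \<or> c = -1" using Cons.prems by auto
    ultimately show ?case by (auto; presburger)
  qed simp
  have setq: "set q \<subseteq> {1, -1}" and setr: "set r \<subseteq> {1, -1}" using set p'_eq by auto
  have "even (length q)" using par[OF setq] q0 by simp
  then obtain i where i: "length q = 2 * i" by (elim evenE)
  have q: "q \<in> dyck_paths i" using i setq qpos q0 by (auto simp: dyck_paths_altdef)
  have len: "length r + 2 * i = 2 * n" using p ap p'_eq i by (auto simp: dyck_paths_altdef)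
  have "sum_list u \<ge> 0" if "r = u @ v" for u v
    using dyck_paths_prefix[OF p, of "1 # q @ -1 # u" v] that ap a p'_eq q0 by simp
  then have r: "r \<in> dyck_paths (n - i)" using len setr tot p'_eq q0 by (auto simp: dyck_paths_altdef)
  have "p = arch (q, r)" using ap a p'_eq by (simp add: arch_def)
  moreover have "i \<le> n" using len by simp
  ultimately show "p \<in> arch ` (\<Union>i\<le>n. dyck_paths i \<times> dyck_paths (n - i))" using q r by blast
qed

section \<open>Peaks under the decomposition and the resulting continued fraction\<close>

lemma peak_heights_pos: "p \<in> dyck_paths n \<Longrightarrow> h \<in> peak_heights p \<Longrightarrow> h > 0"
  unfolding peak_heights_altdef using dyck_paths_prefix[of p n] by fastforce

text \<open>No peak straddles a junction unless q is empty, since a nonempty Dyck path starts with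
  an up-step and ends with a down-step.\<close>

lemma peak_heights_arch:
  assumes q: "q \<in> dyck_paths i" and r: "r \<in> dyck_paths j"
  shows "peak_heights (arch (q, r)) =
    (if q = [] then {1} else (\<lambda>h. h + 1) ` peak_heights q) \<union> peak_heights r"
proof (intro equalityI subsetI)
  have q0: "sum_list q = 0" using q by (simp add: dyck_paths_altdef)
  fix h assume "h \<in> peak_heights (arch (q, r))"
  then obtain u v where h: "h = sum_list u + 1" and e: "1 # q @ -1 # r = u @ 1 # -1 # v"
    by (auto simp: peak_heights_altdef arch_def)
  show "h \<in> (if q = [] then {1} else (\<lambda>h. h + 1) ` peak_heights q) \<union> peak_heights r"
  proof (cases u)
    case Nil
    then have e1: "q @ -1 # r = -1 # v" using e by simp
    have "q = []"
    proof (cases q)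
      case (Cons c q')
      then have "c = -1" using e1 by simp
      then show ?thesis using dyck_paths_prefix[OF q, of "[c]" q'] Cons by simp
    qed
    then show ?thesis using Nil h by simp
  next
    case (Cons c u')
    then have c: "c = 1" and e2: "q @ -1 # r = u' @ 1 # -1 # v" using e by auto
    obtain us where
      "q = u' @ us \<and> us @ -1 # r = 1 # -1 # v \<or> q @ us = u' \<and> -1 # r = us @ 1 # -1 # v"
      using e2 unfolding append_eq_append_conv2 by (elim exE)
    then consider "q = u' @ us" "us @ -1 # r = 1 # -1 # v" | "u' = q @ us" "-1 # r = us @ 1 # -1 # v"
      by (elim disjE conjE) (simp_all only: refl)
    then show ?thesis
    proof cases
      case 1
      then obtain us' where us: "us = 1 # us'" "us' @ -1 # r = -1 # v" by (cases us) auto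
      show ?thesis
      proof (cases us')
        case Nil
        then have "sum_list u' = -1" using q0 1 us by simp
        then show ?thesis using dyck_paths_prefix[OF q 1(1)] by simp
      next
        case (Cons d us'')
        then have "q = u' @ 1 # -1 # us''" using 1 us by simp
        then have q: "sum_list u' + 1 \<in> peak_heights q" "q \<noteq> []" by (auto simp: peak_heights_altdef)
        have "h = (sum_list u' + 1) + 1" using h \<open>u = c # u'\<close> c by simp
        then have "h \<in> (\<lambda>h. h + 1) ` peak_heights q" using q(1) by (rule image_eqI)
        then show ?thesis using q(2) by simp
      qed
    next
      case 2
      then obtain us' where "us = -1 # us'" "r = us' @ 1 # -1 # v" by (cases us) auto
      then have "h \<in> peak_heights r"
        unfolding peak_heights_altdef using h \<open>u = c # u'\<close> c 2 q0 by auto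
      then show ?thesis by simp
    qed
  qed
next
  have q0: "sum_list q = 0" using q by (simp add: dyck_paths_altdef)
  fix h assume "h \<in> (if q = [] then {1} else (\<lambda>h. h + 1) ` peak_heights q) \<union> peak_heights r"
  then consider "q = []" "h = 1" | h' where "h' \<in> peak_heights q" "h = h' + 1" | "h \<in> peak_heights r"
    by (auto split: if_splits)
  then have "\<exists>u v. h = sum_list u + 1 \<and> 1 # q @ -1 # r = u @ 1 # -1 # v"
  proof cases
    case 1
    then show ?thesis by (intro exI[of _ "[]"] exI[of _ r]) simp
  next
    case 2
    then obtain u v where "h' = sum_list u + 1" "q = u @ 1 # -1 # v" by (auto simp: peak_heights_altdef)
    then show ?thesis using 2 by (intro exI[of _ "1 # u"] exI[of _ "v @ -1 # r"]) simp
  next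
    case 3
    then obtain u v where "h = sum_list u + 1" "r = u @ 1 # -1 # v" by (auto simp: peak_heights_altdef)
    then show ?thesis using q0 by (intro exI[of _ "1 # q @ -1 # u"] exI[of _ v]) simp
  qed
  then show "h \<in> peak_heights (arch (q, r))" by (simp add: peak_heights_altdef arch_def)
qed

text \<open>The offset h stands for paths that start at height h; \<open>nat\<close> is harmless
  because peak heights are positive.\<close>

definition avoiding :: "(nat \<Rightarrow> bool) \<Rightarrow> nat \<Rightarrow> nat \<Rightarrow> int list set" where
  "avoiding \<chi> h n = {p \<in> dyck_paths n. \<forall>y\<in>peak_heights p. \<not> \<chi> (nat y + h)}"

definition avoiding_gf :: "(nat \<Rightarrow> bool) \<Rightarrow> nat \<Rightarrow> int fps" where
  "avoiding_gf \<chi> h = Abs_fps (\<lambda>n. int (card (avoiding \<chi> h n)))"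

lemma finite_avoiding: "finite (avoiding \<chi> h n)"
  by (simp add: avoiding_def finite_dyck_paths)

lemma avoiding_0: "avoiding \<chi> h 0 = {[]}"
  by (auto simp: avoiding_def dyck_paths_0 peak_heights_altdef)

lemma arch_in_avoiding:
  assumes q: "q \<in> dyck_paths i" and r: "r \<in> dyck_paths j"
  shows "arch (q, r) \<in> avoiding \<chi> h (Suc (i + j)) \<longleftrightarrow>
    q \<in> avoiding \<chi> (Suc h) i - (if \<chi> (Suc h) then {[]} else {}) \<and> r \<in> avoiding \<chi> h j"
proof (cases "q = []")
  case True
  have "peak_heights [] = {}" by (simp add: peak_heights_altdef)
  then show ?thesis
    using arch_in_dyck_paths[OF q r] q r peak_heights_arch[OF q r] True by (simp add: avoiding_def)
next
  case False
  have "nat (y + 1) + h = nat y + Suc h" if "y \<in> peak_heights q" for y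
    using peak_heights_pos[OF q that] by simp
  then show ?thesis
    using arch_in_dyck_paths[OF q r] q r peak_heights_arch[OF q r] False
    by (simp add: avoiding_def ball_Un)
qed

lemma avoiding_Suc:
  "avoiding \<chi> h (Suc n) =
     arch ` (\<Union>i\<le>n. (avoiding \<chi> (Suc h) i - (if \<chi> (Suc h) then {[]} else {})) \<times> avoiding \<chi> h (n - i))"
proof (intro equalityI subsetI)
  fix p assume p: "p \<in> avoiding \<chi> h (Suc n)"
  then have "p \<in> dyck_paths (Suc n)" by (simp add: avoiding_def)
  then obtain i q r where i: "i \<le> n" and q: "q \<in> dyck_paths i" and r: "r \<in> dyck_paths (n - i)"
    and p_eq: "p = arch (q, r)"
    unfolding dyck_paths_Suc by blast
  then show "p \<in> arch ` (\<Union>i\<le>n. (avoiding \<chi> (Suc h) i - (if \<chi> (Suc h) then {[]} else {})) \<times> avoiding \<chi> h (n - i))"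
    using arch_in_avoiding[OF q r, of \<chi> h] p unfolding p_eq
    by (intro imageI) auto
next
  fix p
  assume "p \<in> arch ` (\<Union>i\<le>n. (avoiding \<chi> (Suc h) i - (if \<chi> (Suc h) then {[]} else {})) \<times> avoiding \<chi> h (n - i))"
  then obtain i q r where i: "i \<le> n" and p: "p = arch (q, r)"
    and q: "q \<in> avoiding \<chi> (Suc h) i - (if \<chi> (Suc h) then {[]} else {})" and r: "r \<in> avoiding \<chi> h (n - i)"
    by blast
  have "q \<in> dyck_paths i" "r \<in> dyck_paths (n - i)" using q r by (simp_all add: avoiding_def)
  then show "p \<in> avoiding \<chi> h (Suc n)"
    using arch_in_avoiding[of q i r "n - i" \<chi> h] i p q r by simp
qed


lemma card_avoiding_Suc:
  "int (card (avoiding \<chi> h (Suc n))) =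
     (\<Sum>i=0..n. (avoiding_gf \<chi> (Suc h) - (if \<chi> (Suc h) then 1 else 0)) $ i * avoiding_gf \<chi> h $ (n - i))"
proof -
  define A where "A i = avoiding \<chi> (Suc h) i - (if \<chi> (Suc h) then {[]} else {})" for i
  have A_sub: "A i \<subseteq> dyck_paths i" "avoiding \<chi> h i \<subseteq> dyck_paths i" for i
    by (auto simp: A_def avoiding_def)
  have disj: "dyck_paths i \<inter> dyck_paths i' = {}" if "i \<noteq> i'" for i i'
    using that by (auto simp: dyck_paths_def)
  have cardA: "int (card (A i)) = (avoiding_gf \<chi> (Suc h) - (if \<chi> (Suc h) then 1 else 0)) $ i" for i
  proof (cases i)
    case 0
    then show ?thesis by (simp add: A_def avoiding_gf_def avoiding_0)
  next
    case (Suc i')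
    have "[] \<notin> avoiding \<chi> (Suc h) (Suc i')" by (simp add: avoiding_def dyck_paths_def)
    then show ?thesis using Suc by (simp add: A_def avoiding_gf_def)
  qed
  have "card (avoiding \<chi> h (Suc n)) = card (\<Union>i\<le>n. A i \<times> avoiding \<chi> h (n - i))"
    unfolding avoiding_Suc A_def[symmetric]
  proof (rule card_image, rule inj_on_subset[OF inj_arch[of n]])
    show "(\<Union>i\<le>n. A i \<times> avoiding \<chi> h (n - i)) \<subseteq> (\<Union>i\<le>n. dyck_paths i \<times> dyck_paths (n - i))"
      using A_sub by blast
  qed
  also have "\<dots> = (\<Sum>i\<le>n. card (A i \<times> avoiding \<chi> h (n - i)))"
  proof (rule card_UN_disjoint)
    show "\<forall>i\<in>{..n}. finite (A i \<times> avoiding \<chi> h (n - i))"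
      by (simp add: A_def finite_avoiding)
    show "\<forall>i\<in>{..n}. \<forall>j\<in>{..n}. i \<noteq> j \<longrightarrow> (A i \<times> avoiding \<chi> h (n - i)) \<inter> (A j \<times> avoiding \<chi> h (n - j)) = {}"
      using disj A_sub by blast
  qed simp
  finally show ?thesis
    by (simp add: card_cartesian_product cardA atMost_atLeast0 avoiding_gf_def)
qed

lemma avoiding_gf_step:
  "avoiding_gf \<chi> h * (1 + (if \<chi> (Suc h) then fps_X else 0) - fps_X * avoiding_gf \<chi> (Suc h)) = 1"
proof -
  \<comment> \<open>\<open>E\<close> removes the empty interior, whose arch would be a peak at the
    forbidden height h + 1.\<close>
  define E :: "int fps" where "E = (if \<chi> (Suc h) then 1 else 0)"
  have "avoiding_gf \<chi> h = 1 + fps_X * ((avoiding_gf \<chi> (Suc h) - E) * avoiding_gf \<chi> h)"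
  proof (rule fps_ext)
    fix n
    show "avoiding_gf \<chi> h $ n = (1 + fps_X * ((avoiding_gf \<chi> (Suc h) - E) * avoiding_gf \<chi> h)) $ n"
    proof (cases n)
      case 0
      then show ?thesis by (simp add: avoiding_gf_def avoiding_0)
    next
      case (Suc n')
      have "avoiding_gf \<chi> h $ Suc n' = int (card (avoiding \<chi> h (Suc n')))"
        by (simp add: avoiding_gf_def)
      also have "\<dots> = ((avoiding_gf \<chi> (Suc h) - E) * avoiding_gf \<chi> h) $ n'"
        unfolding card_avoiding_Suc E_def[symmetric] by (simp add: fps_mult_nth)
      finally show ?thesis using Suc by simp
    qed
  qed
  moreover have "(if \<chi> (Suc h) then fps_X else 0) = fps_X * E" by (simp add: E_def)
  ultimately show ?thesis by (simp add: algebra_simps)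
qed

subsection \<open>Periodicity\<close>

text \<open>By \<open>avoiding_gf_step\<close> the new factor is the inverse of the previous series,
  so each level is a substitution by a matrix of determinant x.\<close>

lemma cf_row_moebius:
  assumes row: "cf_row \<chi> (1, 0) s = (\<alpha>, \<beta>)" "cf_row \<chi> (0, 1) s = (\<gamma>, \<delta>)"
  shows "avoiding_gf \<chi> 0 * (\<gamma> * avoiding_gf \<chi> s + \<delta>) = \<alpha> * avoiding_gf \<chi> s + \<beta>"
    and "\<alpha> * \<delta> - \<beta> * \<gamma> = fps_X ^ s" and "\<delta> $ 0 = 1" and "\<gamma> $ 0 = 0"
proof -
  have "avoiding_gf \<chi> 0 * (\<gamma> * avoiding_gf \<chi> s + \<delta>) = \<alpha> * avoiding_gf \<chi> s + \<beta> \<and>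
    \<alpha> * \<delta> - \<beta> * \<gamma> = fps_X ^ s \<and> \<delta> $ 0 = 1 \<and> \<gamma> $ 0 = 0"
    using row
  proof (induction s arbitrary: \<alpha> \<beta> \<gamma> \<delta>)
    case 0
    then show ?case by auto
  next
    case (Suc s)
    obtain a b c d where ab: "cf_row \<chi> (1, 0) s = (a, b)" and cd: "cf_row \<chi> (0, 1) s = (c, d)"
      by (metis surj_pair)
    note IH = Suc.IH[OF ab cd]
    define u where "u = 1 + x_if \<chi> (Suc s)"
    define F where "F = avoiding_gf \<chi>"
    have eqs: "\<alpha> = - fps_X * b" "\<beta> = a + u * b" "\<gamma> = - fps_X * d" "\<delta> = c + u * d"
      using Suc.prems ab cd by (auto simp: u_def)
    have step: "F s * (u - fps_X * F (Suc s)) = 1"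
      using avoiding_gf_step[of \<chi> s] by (simp add: F_def u_def x_if_def)
    have "F 0 * (\<gamma> * F (Suc s) + \<delta>) = F 0 * (c + d * (u - fps_X * F (Suc s)))"
      by (simp add: eqs algebra_simps)
    also have "\<dots> = F 0 * (c * (F s * (u - fps_X * F (Suc s))) + d * (u - fps_X * F (Suc s)))"
      by (simp add: step)
    also have "\<dots> = (F 0 * (c * F s + d)) * (u - fps_X * F (Suc s))"
      by (simp add: algebra_simps)
    also have "\<dots> = (a * F s + b) * (u - fps_X * F (Suc s))"
      using IH by (simp add: F_def)
    also have "\<dots> = a * (F s * (u - fps_X * F (Suc s))) + b * (u - fps_X * F (Suc s))"
      by (simp add: algebra_simps)
    also have "\<dots> = \<alpha> * F (Suc s) + \<beta>"
      unfolding step by (simp add: eqs algebra_simps)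
    finally have 1: "F 0 * (\<gamma> * F (Suc s) + \<delta>) = \<alpha> * F (Suc s) + \<beta>" .
    have "\<alpha> * \<delta> - \<beta> * \<gamma> = fps_X * (a * d - b * c)"
      by (simp add: eqs algebra_simps)
    then have 2: "\<alpha> * \<delta> - \<beta> * \<gamma> = fps_X ^ Suc s" using IH by simp
    have 3: "\<delta> $ 0 = 1 \<and> \<gamma> $ 0 = 0" using IH by (simp add: eqs u_def x_if_def)
    show ?case using 1 2 3 by (simp add: F_def)
  qed
  then show "avoiding_gf \<chi> 0 * (\<gamma> * avoiding_gf \<chi> s + \<delta>) = \<alpha> * avoiding_gf \<chi> s + \<beta>"
    and "\<alpha> * \<delta> - \<beta> * \<gamma> = fps_X ^ s" and "\<delta> $ 0 = 1" and "\<gamma> $ 0 = 0" by blast+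
qed

section \<open>Two periods as a Moebius map fixing the generating function\<close>

context peak_blocks
begin

text \<open>Height 0 is excluded: it is never forbidden, whereas 2m is forbidden if m belongs to
  V.\<close>

lemma forbidden_shift:
  assumes "h > 0"
  shows "forbidden (h + 2 * nat m) = forbidden h"
proof -
  have "[int (h + 2 * nat m) = int h] (mod m)"
    using m_pos by (simp add: cong_iff_dvd_diff)
  then have "[int (h + 2 * nat m) = j] (mod m) \<longleftrightarrow> [int h = j] (mod m)" for j
    by (metis cong_sym cong_trans)
  then show ?thesis
    using assms unfolding forbidden_def residue_set_def by simp
qed

lemma avoiding_gf_periodic: "avoiding_gf forbidden (2 * nat m) = avoiding_gf forbidden 0"
proof -
  have "avoiding forbidden (2 * nat m) n = avoiding forbidden 0 n" for n
    unfolding avoiding_def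
  proof (intro Collect_cong conj_cong refl ball_cong arg_cong[where f = Not])
    fix p y assume "p \<in> dyck_paths n" "y \<in> peak_heights p"
    then have "nat y > 0" using peak_heights_pos by simp
    then show "forbidden (nat y + 2 * nat m) = forbidden (nat y + 0)" using forbidden_shift by simp
  qed
  then show ?thesis by (simp add: avoiding_gf_def)
qed

lemma dyck_gf_eq: "dyck_gf m V = avoiding_gf forbidden 0"
proof -
  have "{p \<in> dyck_paths n. peak_heights p \<inter> residue_set m V = {}} = avoiding forbidden 0 n" for n
    unfolding avoiding_def
  proof (intro Collect_cong conj_cong refl)
    fix p assume p: "p \<in> dyck_paths n"
    have "forbidden (nat y + 0) \<longleftrightarrow> y \<in> residue_set m V" if "y \<in> peak_heights p" for y
      using peak_heights_pos[OF p that] by (simp add: forbidden_def)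
    then show "peak_heights p \<inter> residue_set m V = {} \<longleftrightarrow> (\<forall>y\<in>peak_heights p. \<not> forbidden (nat y + 0))"
      by auto
  qed
  then show ?thesis by (simp add: dyck_gf_def dyck_count_def avoiding_gf_def)
qed

lemma hankel_seq_periodic: "periodic (hankel_seq (dyck_gf m V))"
proof -
  define M where "M = nat m"
  define F where "F = dyck_gf m V"
  have M: "M > 0" using m_pos by (simp add: M_def)
  obtain \<alpha> \<beta> \<gamma> \<delta> where ab: "cf_row forbidden (1, 0) (2 * M) = (\<alpha>, \<beta>)" and cd: "cf_row forbidden (0, 1) (2 * M) = (\<gamma>, \<delta>)"
    by (metis surj_pair)
  have reduced: "reduced (N + M) (cf_row forbidden p (2 * M))" if "reduced N p" for N p
  proof -
    have "reduced (N + 2 * M div 2) (cf_row forbidden p (2 * M))"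
      using reduced_at_two_periods[folded M_def] that unfolding reduced_at_def by blast
    then show ?thesis by simp
  qed
  \<comment> \<open>The identity rows (1, 0) and (0, 1) are reduced with bounds 0 and 1, which
    accounts for the different degrees M and M + 1 in \<open>hankel_moebius\<close>.\<close>
  have "reduced (0 + M) (\<alpha>, \<beta>)"
    unfolding ab[symmetric] by (rule reduced) (simp add: reduced_def)
  moreover have "reduced (1 + M) (\<gamma>, \<delta>)"
    unfolding cd[symmetric] by (rule reduced) (simp add: reduced_def)
  moreover have "F * (\<gamma> * F + \<delta>) = \<alpha> * F + \<beta>"
    using cf_row_moebius(1)[OF ab cd] avoiding_gf_periodic by (simp add: M_def F_def dyck_gf_eq)
  ultimately interpret hankel_moebius F F \<alpha> \<beta> \<gamma> \<delta> M
    using cf_row_moebius(2-4)[OF ab cd] M by unfold_locales (auto simp: reduced_def)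
  have "\<bar>hankel_det M F\<bar> = 1" using hankel_det_unit by simp
  then have sq: "hankel_det M F * hankel_det M F = 1" by (auto simp: abs_if split: if_splits)
  \<comment> \<open>Each shift by M contributes a factor 1 or -1, the same both times, so two shifts
    cancel the sign.\<close>
  have "hankel_seq F (n + 2 * M) = hankel_seq F n" for n
    using hankel_det_shift[of "M + Suc n"] hankel_det_shift[of "Suc n"] sq
    by (simp add: hankel_seq_def add_ac mult_2 flip: mult.assoc)
  then show ?thesis unfolding periodic_def F_def[symmetric] using M by (intro exI[of _ "2 * M"]) simp
qed

end

theorem theorem1p6:
  fixes b :: nat and \<alpha> :: "nat \<Rightarrow> nat list" and k :: "nat \<Rightarrow> int"
    and V :: "int set" and m :: int
  assumes "b \<ge> 1"
    and "\<And>j. j \<in> {1..b} \<Longrightarrow> primitive (\<alpha> j)"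
    and "k 1 \<ge> -1"
    and "\<And>j. 1 \<le> j \<Longrightarrow> j \<le> b - 1 \<Longrightarrow>
           k (j + 1) \<ge> Max (shift_set (height_set (\<alpha> j)) (k j)) - 1"
    and "V = (\<Union>j\<in>{1..b}. shift_set (height_set (\<alpha> j)) (k j))"
    and "m \<ge> Max V"
  shows "periodic (hankel_seq (dyck_gf m V))"
proof -
  interpret peak_blocks b \<alpha> k V m
    using assms by unfold_locales
  show ?thesis by (rule hankel_seq_periodic)
qed

end
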